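(* Let $N \ge 1$ be an integer, let $\mathcal{K}_N$ be the complete graph on a vertex set $\mathcal{V}$ with $|\mathcal{V}| = N$, and let $\mathcal{T}_N$ be a star spanning tree of $\mathcal{K}_N$, i.e. the graph on $\mathcal{V}$ with edge set $\{(u_c, v) \mid v \in \mathcal{V}\setminus\{u_c\}\}$ for some central node $u_c \in \mathcal{V}$. Then $\mathcal{T}_N$ is an $N$-approximation of $\mathcal{K}_N$, that is, $$\tfrac{1}{N}\,\boldsymbol{L}_{\mathcal{T}_N} \preceq \boldsymbol{L}_{\mathcal{K}_N} \preceq N\,\boldsymbol{L}_{\mathcal{T}_N}.$$
   Context: Graphs are finite, simple, undirected and unweighted (all edge weights are 1). For a graph $\mathcal{G}$ with vertex set $\mathcal{V}$ and edge set $\mathcal{E}$, $\boldsymbol{L}_{\mathcal{G}}$ denotes its Laplacian, the $\mathcal{V}\times\mathcal{V}$ real symmetric matrix acting on $\boldsymbol{x} \in \mathbb{R}^{\mathcal{V}}$ by $(\boldsymbol{L}_{\mathcal{G}}\boldsymbol{x})(a) = \sum_{b : (a,b)\in \mathcal{E}} (\boldsymbol{x}(a) - \boldsymbol{x}(b))$. The symbol $\preceq$ is the Loewner partial order on real symmetric matrices: $A \preceq B$ means that $B - A$ is positive semidefinite. For two graphs $\mathcal{G}$, $\hat{\mathcal{G}}$ on the same vertex set and $\sigma > 0$, $\hat{\mathcal{G}}$ is called a $\sigma$-approximation of $\mathcal{G}$ if $\frac{1}{\sigma}\boldsymbol{L}_{\hat{\mathcal{G}}} \preceq \boldsymbol{L}_{\mathcal{G}}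 \preceq \sigma \boldsymbol{L}_{\hat{\mathcal{G}}}$. *)

theory Defs
  imports "HOL-Analysis.Analysis"
begin

text \<open>
  A graph on the finite vertex set \<open>UNIV :: 'v set\<close> is given by its set of undirected edges, each
  edge being the two-element set of its endpoints.
\<close>

definition simple_graph :: "'v::finite set set \<Rightarrow> bool" where
  "simple_graph E \<longleftrightarrow> (\<forall>e\<in>E. card e = 2)"

definition complete_graph :: "'v::finite set set" where
  "complete_graph = {{u, v} | u v. u \<noteq> v}"

definition star_graph :: "'v::finite \<Rightarrow> 'v set set" where
  "star_graph c = {{c, v} | v. v \<in> UNIV - {c}}"

definition laplacian :: "'v::finite set set \<Rightarrow> real ^ 'v ^ 'v" where
  "laplacian E = matrix (\<lambda>x. \<chi> a. \<Sum>b | {a, b} \<in> E. x $ a - x $ b)"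

lemma laplacian_mult:
  "laplacian E *v x = (\<chi> a. \<Sum>b | {a, b} \<in> E. x $ a - x $ b)"
proof -
  have "linear (\<lambda>x :: real ^ 'a. \<chi> a. \<Sum>b | {a, b} \<in> E. x $ a - x $ b)"
    by (rule linearI)
      (simp_all add: vec_eq_iff sum.distrib[symmetric] sum_distrib_left algebra_simps)
  then show ?thesis
    unfolding laplacian_def by (simp add: matrix_works linear_matrix_vector_mul_eq)
qed

definition symmetric_matrix :: "real ^ 'n ^ 'n \<Rightarrow> bool" where
  "symmetric_matrix A \<longleftrightarrow> transpose A = A"

definition pos_semidef :: "real ^ 'n::finite ^ 'n \<Rightarrow> bool" where
  "pos_semidef A \<longleftrightarrow> symmetric_matrix A \<and> (\<forall>x. 0 \<le> x \<bullet> (A *v x))"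

definition loewner_le :: "real ^ 'n::finite ^ 'n \<Rightarrow> real ^ 'n ^ 'n \<Rightarrow> bool"
    (infix "\<preceq>\<^sub>L" 50) where
  "A \<preceq>\<^sub>L B \<longleftrightarrow> symmetric_matrix A \<and> symmetric_matrix B \<and> pos_semidef (B - A)"

text \<open>\<open>sigma_approximation \<sigma> H G\<close>: the graph \<open>H\<close> is a \<open>\<sigma>\<close>-approximation of the graph \<open>G\<close>.\<close>

definition sigma_approximation :: "real \<Rightarrow> 'v::finite set set \<Rightarrow> 'v set set \<Rightarrow> bool" where
  "sigma_approximation \<sigma> H G \<longleftrightarrow>
     \<sigma> > 0 \<and> simple_graph H \<and> simple_graph G \<and>
     (1 / \<sigma>) *\<^sub>R laplacian H \<preceq>\<^sub>L laplacian G \<and> laplacian G \<preceq>\<^sub>L \<sigma> *\<^sub>R laplacian H"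

end

theory Submission
  imports Defs
begin

text \<open>
  The quadratic form of a Laplacian is \<open>x\<^sup>T L x = (\<Sum>(x a - x b)\<^sup>2) / 2\<close>, summed over ordered adjacent
  pairs, so it is monotone in the edge set; this gives the lower bound, as the star is a subgraph.
  For the upper bound put \<open>y = x - x c\<close> with \<open>c\<close> the centre: the form of the complete graph is
  \<open>N \<Sum>y\<^sup>2 - (\<Sum>y)\<^sup>2\<close>, and that of the star is \<open>\<Sum>y\<^sup>2\<close>.
\<close>

text \<open>Averaging the double sum with its copy under exchange of \<open>a\<close> and
  \<open>b\<close> turns \<open>y $ a\<close> into half of \<open>y $ a - y $ b\<close>. Two vectors
  are kept, instead of the quadratic form alone, because the symmetry of the matrix is read off from
  the bilinear form.\<close>

lemma inner_laplacian:
  "y \<bullet> (laplacian E *v x) =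
    (\<Sum>a\<in>UNIV. \<Sum>b\<in>UNIV. if {a, b} \<in> E then (y $ a - y $ b) * (x $ a - x $ b) else 0) / 2"
proof -
  let ?f = "\<lambda>a b. if {a, b} \<in> E then y $ a * (x $ a - x $ b) else 0"
  have form: "y \<bullet> (laplacian E *v x) = (\<Sum>a\<in>UNIV. \<Sum>b\<in>UNIV. ?f a b)"
    by (simp add: laplacian_mult inner_vec_def sum_distrib_left sum.inter_filter[symmetric])
  have swap: "y \<bullet> (laplacian E *v x) = (\<Sum>a\<in>UNIV. \<Sum>b\<in>UNIV. ?f b a)"
    unfolding form by (rule sum.swap)
  have "2 * (y \<bullet> (laplacian E *v x)) = (\<Sum>a\<in>UNIV. \<Sum>b\<in>UNIV. ?f a b + ?f b a)"
    using form swap by (simp add: sum.distrib)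
  also have "\<dots> = (\<Sum>a\<in>UNIV. \<Sum>b\<in>UNIV.
      if {a, b} \<in> E then (y $ a - y $ b) * (x $ a - x $ b) else 0)"
    by (intro sum.cong refl) (simp add: insert_commute algebra_simps)
  finally show ?thesis by simp
qed

lemma symmetric_matrix_laplacian: "symmetric_matrix (laplacian E)"
proof -
  \<comment> \<open>Entries are values of the bilinear form at basis vectors, so exchanging
    \<open>i\<close> and \<open>j\<close> only commutes the factors of each product.\<close>
  have entry: "laplacian E $ i $ j = axis i 1 \<bullet> (laplacian E *v axis j 1)" for i j
    by (simp add: matrix_vector_mult_basis column_def inner_axis')
  have "laplacian E $ j $ i = laplacian E $ i $ j" for i j
    unfolding entry inner_laplacian
    by (intro arg_cong[where f = "\<lambda>s. s / 2"] sum.cong refl) (simp only: mult.commute)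
  then show ?thesis
    by (simp add: symmetric_matrix_def transpose_def vec_eq_iff)
qed

lemma symmetric_matrix_scaleR: "symmetric_matrix A \<Longrightarrow> symmetric_matrix (k *\<^sub>R A)"
  by (simp add: symmetric_matrix_def transpose_def vec_eq_iff)

lemma loewner_leI:
  assumes "symmetric_matrix A" and "symmetric_matrix B"
    and "\<And>x. x \<bullet> (A *v x) \<le> x \<bullet> (B *v x)"
  shows "A \<preceq>\<^sub>L B"
  using assms
  by (simp add: loewner_le_def pos_semidef_def symmetric_matrix_def transpose_def vec_eq_iff
      matrix_vector_mult_diff_rdistrib inner_diff_right)

lemma quadratic_form_laplacian_nonneg: "0 \<le> x \<bullet> (laplacian E *v x)"
  by (simp add: inner_laplacian sum_nonneg)

lemma quadratic_form_laplacian_mono: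
  "E \<subseteq> F \<Longrightarrow> x \<bullet> (laplacian E *v x) \<le> x \<bullet> (laplacian F *v x)"
  unfolding inner_laplacian by (intro divide_right_mono sum_mono) auto

lemma star_graph_subset_complete_graph: "star_graph c \<subseteq> complete_graph"
  by (auto simp: star_graph_def complete_graph_def)

lemma simple_graph_complete_graph: "simple_graph complete_graph"
  by (auto simp: simple_graph_def complete_graph_def)

lemma simple_graph_star_graph: "simple_graph (star_graph c)"
  using simple_graph_complete_graph star_graph_subset_complete_graph
  unfolding simple_graph_def by blast

lemma quadratic_form_star_graph:
  "x \<bullet> (laplacian (star_graph c) *v x) = (\<Sum>v\<in>UNIV. (x $ v - x $ c)\<^sup>2)"
proof -
  have edge: "{a, b} \<in> star_graph c \<longleftrightarrow> a \<noteq> b \<and> (a = c \<or> b = c)" for a b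
    by (auto simp: star_graph_def doubleton_eq_iff)
  \<comment> \<open>The two indicators overlap only at \<open>a = b = c\<close>, which is not an
    edge; there both squares vanish, so nothing is counted twice.\<close>
  have "(\<Sum>a\<in>UNIV. \<Sum>b\<in>UNIV.
      if {a, b} \<in> star_graph c then (x $ a - x $ b) * (x $ a - x $ b) else 0) =
      (\<Sum>a\<in>UNIV. \<Sum>b\<in>UNIV. (if a = c then (x $ b - x $ c)\<^sup>2 else 0) +
        (if b = c then (x $ a - x $ c)\<^sup>2 else 0))"
    by (intro sum.cong refl) (auto simp: edge power2_eq_square algebra_simps)
  also have "\<dots> = (\<Sum>a\<in>UNIV. \<Sum>b\<in>UNIV. if a = c then (x $ b - x $ c)\<^sup>2 else 0) +
      (\<Sum>v\<in>UNIV. (x $ v - x $ c)\<^sup>2)"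
    by (simp add: sum.distrib)
  also have "(\<Sum>a\<in>UNIV. \<Sum>b\<in>UNIV. if a = c then (x $ b - x $ c)\<^sup>2 else 0) =
      (\<Sum>v\<in>UNIV. (x $ v - x $ c)\<^sup>2)"
    by (subst sum.swap) simp
  finally show ?thesis
    by (simp add: inner_laplacian)
qed

text \<open>The form sees only differences of coordinates, so any shift \<open>t\<close> is allowed;
  the diagonal terms are zero, and expanding the square over all ordered pairs gives the formula.
  Leaving \<open>t\<close> free lets it be matched to the star later.\<close>

lemma quadratic_form_complete_graph:
  fixes x :: "real ^ 'v::finite"
  shows "x \<bullet> (laplacian complete_graph *v x) =
    real CARD('v) * (\<Sum>v\<in>UNIV. (x $ v - t)\<^sup>2) - (\<Sum>v\<in>UNIV. x $ v - t)\<^sup>2"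
proof -
  let ?y = "\<lambda>v. x $ v - t"
  have edge: "{a, b} \<in> complete_graph \<longleftrightarrow> a \<noteq> b" for a b :: 'v
    by (auto simp: complete_graph_def doubleton_eq_iff)
  have "(\<Sum>a\<in>UNIV. \<Sum>b\<in>UNIV.
      if {a, b} \<in> complete_graph then (x $ a - x $ b) * (x $ a - x $ b) else 0) =
      (\<Sum>a\<in>UNIV. \<Sum>b\<in>UNIV. (?y a)\<^sup>2 + (?y b)\<^sup>2 - 2 * (?y a * ?y b))"
    by (intro sum.cong refl) (auto simp: edge power2_eq_square algebra_simps)
  \<comment> \<open>The square of the sum is written as a double sum so that it matches the cross
    terms.\<close>
  also have "\<dots> = 2 * (real CARD('v) * (\<Sum>v\<in>UNIV. (?y v)\<^sup>2)) - 2 * (\<Sum>v\<in>UNIV. ?y v)\<^sup>2"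
    unfolding power2_eq_square[of "\<Sum>v\<in>UNIV. ?y v"] sum_product
    by (simp only: sum.distrib sum_subtractf sum_distrib_left[symmetric] sum_constant mult_2)
  finally show ?thesis
    by (simp add: inner_laplacian)
qed

theorem lemma4:
  fixes N :: nat and u_c :: "'v::finite"
  assumes "N \<ge> 1" and "CARD('v) = N"
  shows "sigma_approximation (real N) (star_graph u_c) (complete_graph :: 'v set set)"
proof -
  let ?S = "laplacian (star_graph u_c)" and ?K = "laplacian (complete_graph :: 'v set set)"
  have lower: "x \<bullet> (((1 / real N) *\<^sub>R ?S) *v x) \<le> x \<bullet> (?K *v x)" for x
  proof -
    have "x \<bullet> (((1 / real N) *\<^sub>R ?S) *v x) = (1 / real N) * (x \<bullet> (?S *v x))"
      by (simp add: scaleR_matrix_vector_assoc[symmetric])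
    \<comment> \<open>\<open>N \<ge> 1\<close> gives \<open>1 / N \<le> 1\<close>, and the form is
      nonnegative.\<close>
    also have "\<dots> \<le> x \<bullet> (?S *v x)"
      using assms(1) by (intro mult_left_le_one_le quadratic_form_laplacian_nonneg) auto
    also have "\<dots> \<le> x \<bullet> (?K *v x)"
      by (intro quadratic_form_laplacian_mono star_graph_subset_complete_graph)
    finally show ?thesis .
  qed
  have upper: "x \<bullet> (?K *v x) \<le> x \<bullet> ((real N *\<^sub>R ?S) *v x)" for x
    using quadratic_form_complete_graph[of x "x $ u_c"]
    by (simp add: scaleR_matrix_vector_assoc[symmetric] quadratic_form_star_graph assms(2))
  show ?thesis
    using assms(1) lower upper
    by (auto simp: sigma_approximation_def intro!: loewner_leI symmetric_matrix_scaleR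
        symmetric_matrix_laplacian simple_graph_complete_graph simple_graph_star_graph)
qed

end
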